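(* Let $\bar a=(a_1,\dots,a_s)$ be a composition and let $l$ be a positive integer with $2l\le\min_i a_i$. Then the rank polynomial of the chainlink poset $\mathrm{P_{CL}}(\bar a,l)$ is symmetric (palindromic).
   Context: A composition is a finite tuple of positive integers. For a composition $\bar a=(a_1,\dots,a_s)$ and a positive integer $l$ with $2l\le\min_i a_i$, the chainlink poset $\mathrm{P_{CL}}(\bar a,l)$ has elements $y_{i,j}$ for $1\le i\le s$, $1\le j\le a_i$, with order generated by $y_{i,1}\prec y_{i,2}\prec\dots\prec y_{i,a_i}$ for each $i$, together with $y_{i,a_i-l+j}\succeq y_{i+1,j}$ for each $i$ and $1\le j\le l$ (with $i+1$ taken cyclically modulo $s$). That is, the $l$ top elements of each chain are linked, in order, to lie above the $l$ bottom elements of the next chain. The rank polynomial of a finite poset $P$ is $\sum_I q^{|I|}$ over all lower ideals (down-closed subsets) $I$. A polynomial $f(q)$ is symmetric if $q^Nf(q^{-1})=f(q)$ for some integer $N$. *)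

theory Defs
  imports Complex_Main "HOL-Computational_Algebra.Polynomial"
begin

definition composition :: "nat list \<Rightarrow> bool" where
  "composition a \<longleftrightarrow> a \<noteq> [] \<and> (\<forall>x \<in> set a. 0 < x)"

text \<open>
  The pair \<open>(i, j)\<close> stands for $y_{i+1,j}$: chains are numbered from 0, so that the cyclic
  successor of \<open>i\<close> is \<open>Suc i mod length a\<close>, while positions within a chain are numbered from 1.
  A pair \<open>(x, y)\<close> in a relation means that \<open>x\<close> lies below \<open>y\<close>.
\<close>

definition chainlink_elems :: "nat list \<Rightarrow> (nat \<times> nat) set" where
  "chainlink_elems a = {(i, j). i < length a \<and> 1 \<le> j \<and> j \<le> a ! i}"

definition chainlink_gen :: "nat list \<Rightarrow> nat \<Rightarrow> (nat \<times> nat) rel" where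
  "chainlink_gen a l =
     {((i, j), (i, Suc j)) | i j. i < length a \<and> 1 \<le> j \<and> Suc j \<le> a ! i} \<union>
     {((Suc i mod length a, j), (i, a ! i - l + j)) | i j. i < length a \<and> 1 \<le> j \<and> j \<le> l}"

definition chainlink_le :: "nat list \<Rightarrow> nat \<Rightarrow> (nat \<times> nat) rel" where
  "chainlink_le a l = Restr ((chainlink_gen a l)\<^sup>*) (chainlink_elems a)"

definition lower_ideals :: "'a set \<Rightarrow> 'a rel \<Rightarrow> 'a set set" where
  "lower_ideals P r = {I. I \<subseteq> P \<and> (\<forall>y \<in> I. \<forall>x \<in> P. (x, y) \<in> r \<longrightarrow> x \<in> I)}"

definition rank_poly :: "'a set \<Rightarrow> 'a rel \<Rightarrow> real poly" where
  "rank_poly P r = (\<Sum>I \<in> lower_ideals P r. monom 1 (card I))"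

text \<open>
  The identity $q^N f(q^{-1}) = f(q)$ of Laurent polynomials is expressed by evaluation at all
  nonzero reals, which is the same because there are infinitely many of them.
\<close>

definition symmetric_poly :: "real poly \<Rightarrow> bool" where
  "symmetric_poly f \<longleftrightarrow>
     (\<exists>N :: int. \<forall>q :: real. q \<noteq> 0 \<longrightarrow> q powi N * poly f (inverse q) = poly f q)"

lemma finite_chainlink_elems: "finite (chainlink_elems a)"
proof -
  have "chainlink_elems a = Sigma {..<length a} (\<lambda>i. {1..a ! i})"
    by (auto simp: chainlink_elems_def)
  then show ?thesis by simp
qed

lemma chainlink_gen_elems:
  assumes "composition a" and "2 * l \<le> Min (set a)"
  shows "chainlink_gen a l \<subseteq> chainlink_elems a \<times> chainlink_elems a"
proof -
  have "2 * l \<le> a ! i" if "i < length a" for i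
    using assms(2) that by (meson List.finite_set Min_le nth_mem order_trans)
  note ge = this
  have lt: "Suc i mod length a < length a" for i
    using assms(1) by (simp add: composition_def)
  have "j \<le> a ! (Suc i mod length a)" "a ! i - l + j \<le> a ! i"
    if "i < length a" "j \<le> l" for i j
    using ge[OF lt[of i]] ge[OF that(1)] that(2) by linarith+
  with lt show ?thesis
    by (auto simp: chainlink_gen_def chainlink_elems_def)
qed

lemma partial_order_chainlink:
  assumes "composition a" and "2 * l \<le> Min (set a)"
  shows "partial_order_on (chainlink_elems a) (chainlink_le a l)"
proof -
  have ge: "2 * l \<le> a ! i" if "i < length a" for i
    using assms(2) that by (meson List.finite_set Min_le nth_mem order_trans)
  have less: "snd x < snd y" if "(x, y) \<in> chainlink_gen a l" for x y
    using that by (auto simp: chainlink_gen_def dest!: ge)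
  have le: "x = y \<or> snd x < snd y" if "(x, y) \<in> (chainlink_gen a l)\<^sup>*" for x y
    using that by (induction rule: rtrancl_induct) (auto dest: less)
  have "antisym (chainlink_le a l)"
  proof (rule antisymI)
    fix x y assume "(x, y) \<in> chainlink_le a l" "(y, x) \<in> chainlink_le a l"
    then have "(x, y) \<in> (chainlink_gen a l)\<^sup>*" "(y, x) \<in> (chainlink_gen a l)\<^sup>*"
      by (auto simp: chainlink_le_def)
    then show "x = y" using le[of x y] le[of y x] by auto
  qed
  moreover have "trans (chainlink_le a l)"
    by (rule transI) (auto simp: chainlink_le_def)
  ultimately show ?thesis
    by (auto simp: partial_order_on_def preorder_on_def refl_on_def chainlink_le_def)
qed

end

theory Submission
  imports Defs
begin

text \<open>
  An ideal is determined by the numbers $b_i \le a_i$ of its elements in each chain, subject to the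
  cyclic conditions $b_i \le a_i - l + b_{i+1}$. As $2l \le a_i$, two adjacent conditions are never
  violated together, so the violations can be corrected for by a two-term linear recursion: at $q$
  the rank polynomial equals the trace of the product of the matrices with rows $([a_i + 1]_q, -q^{a_i})$ and
  $(c, 0)$, where $c = \sum_{0 \le b < j \le l} q^{b+j-l}$ is invariant under $q \mapsto q^{-1}$.
  Reversing the polynomial replaces the rows by $([a_i + 1]_q, -1)$ and $(c q^{a_i}, 0)$.
  Since $[a_i + 1]_q = (q^{a_i + 1} - 1) / (q - 1)$, each of these matrices is $q^{a_i} P + Q$ with
  $P$, $Q$ singular and independent of $i$. In both cases $\mathrm{tr}\,P$, $\mathrm{tr}\,Q$ and
  $\mathrm{tr}\,PQ$ are the same, and these determine the trace of every word in two singular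
  $2 \times 2$ matrices.
\<close>

section \<open>Weights of link violations, and transfer matrices\<close>

definition geom :: "real \<Rightarrow> nat \<Rightarrow> real" where
  "geom q a = (\<Sum>b\<le>a. q ^ b)"

text \<open>Up to the factor \<open>q ^ a\<close>, this weighs the heights of a chain of length
  \<open>a\<close> that violate its link to a next chain of height \<open>e\<close>.\<close>

definition tail_weight :: "real \<Rightarrow> nat \<Rightarrow> nat \<Rightarrow> real" where
  "tail_weight q l e = (\<Sum>j\<in>{e<..l}. inverse q ^ (l - j))"

definition link_weight :: "real \<Rightarrow> nat \<Rightarrow> real" where
  "link_weight q l = (\<Sum>b\<le>l. q ^ b * tail_weight q l b)"

text \<open>Heights along an open row of chains; the last chain is linked to a virtual chain of
  height \<open>e\<close>.\<close>

definition link_paths :: "nat \<Rightarrow> nat list \<Rightarrow> nat \<Rightarrow> nat list set" where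
  "link_paths l as e = {bs. length bs = length as \<and>
     (\<forall>i<length as. bs ! i \<le> as ! i \<and> bs ! i \<le> as ! i - l + (bs @ [e]) ! Suc i)}"

definition link_cycles :: "nat \<Rightarrow> nat list \<Rightarrow> nat list set" where
  "link_cycles l as = {bs. length bs = length as \<and>
     (\<forall>i<length as. bs ! i \<le> as ! i \<and> bs ! i \<le> as ! i - l + bs ! (Suc i mod length as))}"

definition path_sum :: "real \<Rightarrow> nat \<Rightarrow> nat list \<Rightarrow> nat \<Rightarrow> real" where
  "path_sum q l as e = (\<Sum>bs\<in>link_paths l as e. q ^ sum_list bs)"

text \<open>Up to a power of \<open>q\<close>, each path is preceded by one more chain that violates
  its link to the path.\<close>

definition tail_path_sum :: "real \<Rightarrow> nat \<Rightarrow> nat list \<Rightarrow> nat \<Rightarrow> real" where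
  "tail_path_sum q l as e =
     (\<Sum>bs\<in>link_paths l as e. q ^ sum_list bs * tail_weight q l (hd (bs @ [e])))"

text \<open>The product of the matrices applied to the column vector \<open>p\<close>; the starts
  \<open>(1, 0)\<close> and \<open>(0, 1)\<close> give its two columns.\<close>

primrec transfer :: "real \<Rightarrow> nat \<Rightarrow> real \<times> real \<Rightarrow> nat list \<Rightarrow> real \<times> real" where
  "transfer q l p [] = p"
| "transfer q l p (a # as) =
     (geom q a * fst (transfer q l p as) - q ^ a * snd (transfer q l p as),
      link_weight q l * fst (transfer q l p as))"

text \<open>The factors are the matrices at \<open>inverse q\<close>, each multiplied by
  \<open>q ^ a\<close>.\<close>

primrec dual_transfer :: "real \<Rightarrow> nat \<Rightarrow> real \<times> real \<Rightarrow> nat list \<Rightarrow> real \<times> real" where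
  "dual_transfer q l p [] = p"
| "dual_transfer q l p (a # as) =
     (geom q a * fst (dual_transfer q l p as) - snd (dual_transfer q l p as),
      link_weight q l * q ^ a * fst (dual_transfer q l p as))"

lemma tail_weight_eq_0: "l \<le> e \<Longrightarrow> tail_weight q l e = 0"
  by (simp add: tail_weight_def)

lemma sum_above_link:
  assumes "q \<noteq> 0" "l \<le> a"
  shows "(\<Sum>b\<in>{a - l + h<..a}. q ^ b) = q ^ a * tail_weight q l h"
proof -
  have "(\<Sum>b\<in>{a - l + h<..a}. q ^ b) = (\<Sum>j\<in>{h<..l}. q ^ a * inverse q ^ (l - j))"
  proof (rule sum.reindex_bij_witness[of _ "\<lambda>j. a - l + j" "\<lambda>b. b - (a - l)"])
    fix b assume b: "b \<in> {a - l + h<..a}"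
    then have "q ^ a = q ^ b * q ^ (a - b)"
      by (simp flip: power_add)
    moreover have "l - (b - (a - l)) = a - b" using b assms by auto
    ultimately show "q ^ a * inverse q ^ (l - (b - (a - l))) = q ^ b"
      using assms by (simp add: power_inverse)
  qed (use assms in auto)
  then show ?thesis by (simp add: tail_weight_def sum_distrib_left)
qed

lemma sum_below_link:
  assumes "q \<noteq> 0" "l \<le> a"
  shows "(\<Sum>b | b \<le> a \<and> b \<le> a - l + h. q ^ b) = geom q a - q ^ a * tail_weight q l h"
proof -
  have "{..a} = {b. b \<le> a \<and> b \<le> a - l + h} \<union> {a - l + h<..a}" by auto
  then have "geom q a = (\<Sum>b | b \<le> a \<and> b \<le> a - l + h. q ^ b) + (\<Sum>b\<in>{a - l + h<..a}. q ^ b)"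
    unfolding geom_def by (simp only:) (rule sum.union_disjoint, auto)
  then show ?thesis using sum_above_link[OF assms] by simp
qed

text \<open>Tail weights vanish from \<open>l\<close> on, so any range that contains all heights
  below \<open>l\<close> gives the same sum.\<close>

lemma sum_tail_weight:
  assumes "finite A" "{..<l} \<subseteq> A"
  shows "(\<Sum>b\<in>A. q ^ b * tail_weight q l b) = link_weight q l"
proof -
  have "(\<Sum>b\<in>A. q ^ b * tail_weight q l b) = (\<Sum>b<l. q ^ b * tail_weight q l b)"
    using assms by (intro sum.mono_neutral_right) (auto simp: tail_weight_eq_0)
  also have "\<dots> = link_weight q l" unfolding link_weight_def
    by (intro sum.mono_neutral_left) (auto simp: tail_weight_eq_0)
  finally show ?thesis .
qed

text \<open>The involution sending \<open>(b, j)\<close> to \<open>(l - j, l - b)\<close> preserves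
  \<open>b < j\<close> and negates the exponent \<open>b - (l - j)\<close>.\<close>

lemma link_weight_inverse: "link_weight (inverse q) l = link_weight q l"
proof -
  have eq: "link_weight q l =
      (\<Sum>(b, j)\<in>Sigma {..l} (\<lambda>b. {b<..l}). q ^ b * inverse q ^ (l - j))" for q
    by (simp add: link_weight_def tail_weight_def sum_distrib_left sum.Sigma)
  show ?thesis unfolding eq
    by (rule sum.reindex_bij_witness[of _ "\<lambda>(b, j). (l - j, l - b)" "\<lambda>(b, j). (l - j, l - b)"])
      auto
qed

lemma geom_inverse: "q \<noteq> 0 \<Longrightarrow> q ^ a * geom (inverse q) a = geom q a"
  unfolding geom_def sum_distrib_left
proof (rule sum.reindex_bij_witness[of _ "\<lambda>b. a - b" "\<lambda>b. a - b"])
  fix b assume "q \<noteq> 0" "b \<in> {..a}"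
  moreover from this have "q ^ a = q ^ (a - b) * q ^ b" by (simp flip: power_add)
  ultimately show "q ^ (a - b) = q ^ a * inverse q ^ b" by (simp add: power_inverse)
qed auto

section \<open>Transfer matrices under inversion of \<open>q\<close>\<close>

lemma transfer_linear:
  "transfer q l (1, r) as =
     (fst (transfer q l (1, 0) as) + r * fst (transfer q l (0, 1) as),
      snd (transfer q l (1, 0) as) + r * snd (transfer q l (0, 1) as))"
  by (induction as) (simp_all add: algebra_simps)

lemma transfer_inverse:
  assumes "q \<noteq> 0"
  shows "q ^ sum_list as * fst (transfer (inverse q) l p as) = fst (dual_transfer q l p as)"
    and "q ^ sum_list as * snd (transfer (inverse q) l p as) = snd (dual_transfer q l p as)"
proof (induction as)
  case (Cons a as)
  have "q ^ a * inverse q ^ a = 1"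
    using assms by (simp flip: power_mult_distrib)
  have "q ^ sum_list (a # as) * fst (transfer (inverse q) l p (a # as)) =
      (q ^ a * geom (inverse q) a) * (q ^ sum_list as * fst (transfer (inverse q) l p as))
      - (q ^ a * inverse q ^ a) * (q ^ sum_list as * snd (transfer (inverse q) l p as))"
    by (simp add: power_add algebra_simps)
  also have "\<dots> = fst (dual_transfer q l p (a # as))"
    by (simp only: Cons.IH geom_inverse[OF assms] \<open>q ^ a * inverse q ^ a = 1\<close>) simp
  finally show "q ^ sum_list (a # as) * fst (transfer (inverse q) l p (a # as)) =
      fst (dual_transfer q l p (a # as))" .
  show "q ^ sum_list (a # as) * snd (transfer (inverse q) l p (a # as)) =
      snd (dual_transfer q l p (a # as))"
    by (simp add: power_add link_weight_inverse flip: Cons.IH(1))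
qed simp_all

lemma trace_dual_transfer:
  assumes "q \<noteq> 1"
  shows "fst (transfer q l (1, 0) as) + snd (transfer q l (0, 1) as) =
    fst (dual_transfer q l (1, 0) as) + snd (dual_transfer q l (0, 1) as)"
proof -
  \<comment> \<open>Coefficients of the geometric sum. P has rows (\<alpha>, -1), (0, 0) and Q has
    rows (\<beta>, 0), (c, 0); in the dual case they are (\<alpha>, 0), (c, 0) and (\<beta>, -1),
    (0, 0). Either way tr P = \<alpha>, tr Q = \<beta>, tr PQ = \<alpha>\<beta> - c.\<close>
  define \<alpha> \<beta> c where "\<alpha> = q / (q - 1)" and "\<beta> = - 1 / (q - 1)" and "c = link_weight q l"
  have geom: "geom q a = \<alpha> * q ^ a + \<beta>" for a
  proof -
    have "geom q a = (q ^ Suc a - 1) / (q - 1)"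
      unfolding geom_def lessThan_Suc_atMost[symmetric] using assms by (rule geometric_sum)
    then show ?thesis by (simp add: \<alpha>_def \<beta>_def diff_divide_distrib)
  qed
  define x y x' y' where
    "x = (\<lambda>p as. fst (transfer q l p as))" and "y = (\<lambda>p as. snd (transfer q l p as))" and
    "x' = (\<lambda>p as. fst (dual_transfer q l p as))" and "y' = (\<lambda>p as. snd (dual_transfer q l p as))"
  have rec: "x p (a # as) = (\<alpha> * q ^ a + \<beta>) * x p as - q ^ a * y p as"
    "y p (a # as) = c * x p as"
    "x' p (a # as) = (\<alpha> * q ^ a + \<beta>) * x' p as - y' p as"
    "y' p (a # as) = c * q ^ a * x' p as" for p a as
    by (simp_all add: x_def y_def x'_def y'_def geom c_def)
  \<comment> \<open>At \<open>e1\<close> and \<open>e2\<close>, the functions \<open>x\<close> and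
    \<open>y\<close> give the first and second column of R.\<close>
  define e1 e2 :: "real \<times> real" where "e1 = (1, 0)" and "e2 = (0, 1)"
  \<comment> \<open>With transfer matrices $q^a P + Q$, the conjuncts equate, for the product $R$ of the matrices
    of either kind, the traces of $R$, $PR$, $QR$ and $PQR$.\<close>
  have "x e1 as + y e2 as = x' e1 as + y' e2 as \<and>
    \<alpha> * x e1 as - y e1 as = \<alpha> * x' e1 as + c * x' e2 as \<and>
    \<beta> * x e1 as + c * x e2 as = \<beta> * x' e1 as - y' e1 as \<and>
    (\<alpha> * \<beta> - c) * x e1 as =
      \<alpha> * \<beta> * x' e1 as - \<alpha> * y' e1 as + c * \<beta> * x' e2 as - c * y' e2 as"
  proof (induction as)
    case Nil
    then show ?case
      by (simp add: x_def y_def x'_def y'_def e1_def e2_def algebra_simps)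
  next
    case (Cons a as)
    then have tr: "x e1 as + y e2 as = x' e1 as + y' e2 as"
      and trP: "\<alpha> * x e1 as - y e1 as = \<alpha> * x' e1 as + c * x' e2 as"
      and trQ: "\<beta> * x e1 as + c * x e2 as = \<beta> * x' e1 as - y' e1 as"
      and trPQ: "(\<alpha> * \<beta> - c) * x e1 as =
        \<alpha> * \<beta> * x' e1 as - \<alpha> * y' e1 as + c * \<beta> * x' e2 as - c * y' e2 as"
      by blast+
    let ?Y = "q ^ a"
    show ?case unfolding rec
    proof (intro conjI, goal_cases)
      case 1
      \<comment> \<open>The new product is (YP + Q)R, with trace Y tr PR + tr QR.\<close>
      show ?case using arg_cong[OF trP, of "(*) ?Y"] trQ by (simp add: algebra_simps)
    next
      case 2
      \<comment> \<open>P is singular, so PP = \<alpha>P.\<close>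
      show ?case using arg_cong[OF trP, of "(*) (\<alpha> * ?Y)"] trPQ by (simp add: algebra_simps)
    next
      case 3
      \<comment> \<open>QQ = \<beta>Q, and polarizing Cayley-Hamilton gives QP = \<alpha>Q +
        \<beta>P - cI - PQ.\<close>
      show ?case using arg_cong[OF tr, of "(*) (c * ?Y)"] arg_cong[OF trP, of "(*) (\<beta> * ?Y)"]
          arg_cong[OF trQ, of "(*) (\<alpha> * ?Y + \<beta>)"] arg_cong[OF trPQ, of "(*) ?Y"]
        by (simp add: algebra_simps)
    next
      case 4
      \<comment> \<open>P has rank one, so PQP = (tr PQ) P; moreover PQQ = \<beta>PQ.\<close>
      show ?case using arg_cong[OF trP, of "(*) (?Y * (\<alpha> * \<beta> - c))"]
          arg_cong[OF trPQ, of "(*) \<beta>"]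
        by (simp add: algebra_simps)
    qed
  qed
  then show ?thesis by (simp add: x_def y_def x'_def y'_def e1_def e2_def)
qed

section \<open>Generating functions of open paths\<close>

lemma link_paths_Nil [simp]: "link_paths l [] e = {[]}"
  by (auto simp: link_paths_def)

lemma Cons_in_link_paths:
  "b # bs \<in> link_paths l (a # as) e \<longleftrightarrow>
     b \<le> a \<and> b \<le> a - l + hd (bs @ [e]) \<and> bs \<in> link_paths l as e"
  by (auto simp: link_paths_def All_less_Suc2 hd_conv_nth)

lemma finite_link_paths: "finite (link_paths l as e)"
proof (rule finite_subset)
  show "link_paths l as e \<subseteq> {bs. set bs \<subseteq> {..Max (set as)} \<and> length bs = length as}"
    by (auto simp: link_paths_def in_set_conv_nth) (meson List.finite_set Max_ge nth_mem order_trans)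
qed (simp add: finite_lists_length_eq)

text \<open>Paths are grouped by their tails: the range of the first height depends on the tail only
  through the next height.\<close>

lemma sum_link_paths_Cons:
  fixes f :: "nat \<Rightarrow> nat list \<Rightarrow> real"
  shows "(\<Sum>bs\<in>link_paths l (a # as) e. f (hd bs) (tl bs)) =
    (\<Sum>bs\<in>link_paths l as e. \<Sum>b | b \<le> a \<and> b \<le> a - l + hd (bs @ [e]). f b bs)"
proof -
  have ne: "bs \<noteq> []" if "bs \<in> link_paths l (a # as) e" for bs
    using that by (auto simp: link_paths_def)
  have paths: "bs \<in> link_paths l (a # as) e \<longleftrightarrow> bs \<noteq> [] \<and> hd bs \<le> a \<and>
      hd bs \<le> a - l + hd (tl bs @ [e]) \<and> tl bs \<in> link_paths l as e" for bs
    using ne Cons_in_link_paths[of "hd bs" "tl bs"] by (cases bs) auto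
  have "(\<Sum>bs\<in>link_paths l as e. \<Sum>b | b \<le> a \<and> b \<le> a - l + hd (bs @ [e]). f b bs) =
    (\<Sum>(bs, b)\<in>Sigma (link_paths l as e) (\<lambda>bs. {b. b \<le> a \<and> b \<le> a - l + hd (bs @ [e])}). f b bs)"
    by (rule sum.Sigma) (auto simp: finite_link_paths)
  also have "\<dots> = (\<Sum>bs\<in>link_paths l (a # as) e. f (hd bs) (tl bs))"
    by (rule sum.reindex_bij_witness[of _ "\<lambda>bs. (tl bs, hd bs)" "\<lambda>(bs, b). b # bs"])
      (auto simp: paths)
  finally show ?thesis ..
qed

text \<open>Prepending a chain gives one matrix factor. The first row counts all heights minus the
  violating ones. In the second row the new height is weighted by its tail weight, so only heights
  below \<open>l\<close> count; as l \<le> a - l, these never violate the new link, and a constant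
  factor remains.\<close>

lemma path_sums_transfer:
  assumes "q \<noteq> 0" "\<forall>a\<in>set as. 2 * l \<le> a"
  shows "(path_sum q l as e, tail_path_sum q l as e) = transfer q l (1, tail_weight q l e) as"
  using assms(2)
proof (induction as)
  case Nil
  then show ?case by (simp add: path_sum_def tail_path_sum_def)
next
  case (Cons a as)
  then have a: "2 * l \<le> a" by simp
  have ne: "bs \<noteq> []" if "bs \<in> link_paths l (a # as) e" for bs
    using that by (auto simp: link_paths_def)
  have "path_sum q l (a # as) e =
      (\<Sum>bs\<in>link_paths l (a # as) e. q ^ hd bs * q ^ sum_list (tl bs))"
    unfolding path_sum_def
    by (intro sum.cong refl) (metis ne list.collapse sum_list.Cons power_add)
  also have "\<dots> = (\<Sum>bs\<in>link_paths l as e.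
      (\<Sum>b | b \<le> a \<and> b \<le> a - l + hd (bs @ [e]). q ^ b) * q ^ sum_list bs)"
    unfolding sum_link_paths_Cons[of "\<lambda>b bs. q ^ b * q ^ sum_list bs"] sum_distrib_right ..
  also have "\<dots> = geom q a * path_sum q l as e - q ^ a * tail_path_sum q l as e"
    unfolding path_sum_def tail_path_sum_def sum_distrib_left sum_subtractf[symmetric]
  proof (intro sum.cong refl)
    fix bs
    show "(\<Sum>b | b \<le> a \<and> b \<le> a - l + hd (bs @ [e]). q ^ b) * q ^ sum_list bs =
        geom q a * q ^ sum_list bs - q ^ a * (q ^ sum_list bs * tail_weight q l (hd (bs @ [e])))"
      using a assms(1) by (subst sum_below_link) (auto simp: algebra_simps)
  qed
  finally have 1: "path_sum q l (a # as) e =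
      geom q a * path_sum q l as e - q ^ a * tail_path_sum q l as e" .
  have "tail_path_sum q l (a # as) e =
      (\<Sum>bs\<in>link_paths l (a # as) e. q ^ hd bs * tail_weight q l (hd bs) * q ^ sum_list (tl bs))"
    unfolding tail_path_sum_def
  proof (intro sum.cong refl)
    fix bs assume "bs \<in> link_paths l (a # as) e"
    then show "q ^ sum_list bs * tail_weight q l (hd (bs @ [e])) =
        q ^ hd bs * tail_weight q l (hd bs) * q ^ sum_list (tl bs)"
      by (cases bs) (auto simp: power_add dest: ne)
  qed
  also have "\<dots> = (\<Sum>bs\<in>link_paths l as e.
      (\<Sum>b | b \<le> a \<and> b \<le> a - l + hd (bs @ [e]). q ^ b * tail_weight q l b) * q ^ sum_list bs)"
    unfolding sum_link_paths_Cons[of "\<lambda>b bs. q ^ b * tail_weight q l b * q ^ sum_list bs"]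
      sum_distrib_right ..
  also have "\<dots> = link_weight q l * path_sum q l as e"
    unfolding path_sum_def sum_distrib_left
  proof (intro sum.cong refl)
    fix bs
    have "(\<Sum>b | b \<le> a \<and> b \<le> a - l + hd (bs @ [e]). q ^ b * tail_weight q l b) = link_weight q l"
      using a by (intro sum_tail_weight) auto
    then show "(\<Sum>b | b \<le> a \<and> b \<le> a - l + hd (bs @ [e]). q ^ b * tail_weight q l b) *
        q ^ sum_list bs = link_weight q l * q ^ sum_list bs" by simp
  qed
  finally show ?case using 1 Cons by (simp add: prod_eq_iff)
qed

text \<open>Once the end height reaches \<open>l\<close>, the last link condition already follows
  from b \<le> a, so the end height no longer matters.\<close>

lemma link_paths_cap:
  assumes "\<forall>a\<in>set as. 2 * l \<le> a" "l \<le> e"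
  shows "link_paths l as e = link_paths l as l"
  using assms(1)
proof (induction as)
  case (Cons a as)
  have "bs \<in> link_paths l (a # as) e \<longleftrightarrow> bs \<in> link_paths l (a # as) l" for bs
  proof (cases bs)
    case Nil
    then show ?thesis by (simp add: link_paths_def)
  next
    case (Cons b bs')
    moreover have "b \<le> a \<and> b \<le> a - l + hd (bs' @ [e]) \<longleftrightarrow> b \<le> a \<and> b \<le> a - l + hd (bs' @ [l])"
      using assms(2) by (cases bs') auto
    ultimately show ?thesis using Cons.IH Cons.prems by (auto simp: Cons_in_link_paths)
  qed
  then show ?case by blast
qed simp

section \<open>Closing paths to cycles\<close>

lemma link_cycles_conv_paths:
  assumes "as \<noteq> []"
  shows "link_cycles l as = {bs. bs \<in> link_paths l as (hd bs)}"
proof -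
  have "(bs @ [hd bs]) ! Suc i = bs ! (Suc i mod length as)"
    if "length bs = length as" "i < length as" for bs :: "nat list" and i
    using that assms by (cases "Suc i = length as"; cases bs) (auto simp: nth_append)
  then show ?thesis by (auto simp: link_cycles_def link_paths_def)
qed

text \<open>The cycle is cut at its first chain, whose height \<open>b\<close> is also the end
  height of the remaining path. Summing over all \<open>b\<close> and subtracting the violations of
  the first link leaves the diagonal entries of the full product.\<close>

lemma sum_link_cycles:
  assumes "q \<noteq> 0" "as \<noteq> []" "\<forall>a\<in>set as. 2 * l \<le> a"
  shows "(\<Sum>bs\<in>link_cycles l as. q ^ sum_list bs) =
    fst (transfer q l (1, 0) as) + snd (transfer q l (0, 1) as)"
proof -
  obtain a as' where as: "as = a # as'" using assms(2) by (cases as) auto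
  have a: "2 * l \<le> a" and as': "\<forall>a\<in>set as'. 2 * l \<le> a" using assms(3) as by auto
  \<comment> \<open>The end height enters only through its tail weight, and linearly, which allows
    summation over it.\<close>
  note path = path_sums_transfer[OF assms(1) as', unfolded transfer_linear[of _ _ "tail_weight _ _ _"]
      prod.inject]
  have ne: "bs \<noteq> []" if "bs \<in> link_cycles l as" for bs
    using that assms(2) by (auto simp: link_cycles_def)
  have cyc: "b # bs \<in> link_cycles l as \<longleftrightarrow>
      b \<le> a \<and> b \<le> a - l + hd (bs @ [b]) \<and> bs \<in> link_paths l as' b" for b bs
    using assms(2) by (simp add: link_cycles_conv_paths as Cons_in_link_paths)
  define bad where "bad b = {bs \<in> link_paths l as' b. a - l + hd (bs @ [b]) < b}" for b
  define good where "good b = {bs \<in> link_paths l as' b. b \<le> a - l + hd (bs @ [b])}" for b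
  have fin: "finite (bad b)" "finite (good b)" for b
    by (auto simp: bad_def good_def finite_link_paths)
  have "(\<Sum>bs\<in>link_cycles l as. q ^ sum_list bs) =
      (\<Sum>(b, bs)\<in>Sigma {..a} good. q ^ b * q ^ sum_list bs)"
  proof (rule sum.reindex_bij_witness[of _ "\<lambda>(b, bs). b # bs" "\<lambda>bs. (hd bs, tl bs)"])
    fix bs assume bs: "bs \<in> link_cycles l as"
    then obtain b bs' where "bs = b # bs'" using ne by (cases bs) auto
    with bs show "(\<lambda>(b, bs). b # bs) (hd bs, tl bs) = bs" "(hd bs, tl bs) \<in> Sigma {..a} good"
      "(\<lambda>(b, bs). q ^ b * q ^ sum_list bs) (hd bs, tl bs) = q ^ sum_list bs"
      by (auto simp: cyc good_def power_add)
  qed (auto simp: cyc good_def)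
  also have "\<dots> = (\<Sum>b\<le>a. \<Sum>bs\<in>good b. q ^ b * q ^ sum_list bs)"
    by (rule sum.Sigma[symmetric]) (auto simp: fin)
  also have "\<dots> = (\<Sum>b\<le>a. q ^ b * path_sum q l as' b - (\<Sum>bs\<in>bad b. q ^ b * q ^ sum_list bs))"
  proof (intro sum.cong refl)
    fix b
    have "link_paths l as' b = good b \<union> bad b" by (auto simp: good_def bad_def)
    moreover have "good b \<inter> bad b = {}" by (auto simp: good_def bad_def)
    ultimately have "q ^ b * path_sum q l as' b =
        (\<Sum>bs\<in>good b. q ^ b * q ^ sum_list bs) + (\<Sum>bs\<in>bad b. q ^ b * q ^ sum_list bs)"
      unfolding path_sum_def sum_distrib_left using fin by (simp add: sum.union_disjoint)
    then show "(\<Sum>bs\<in>good b. q ^ b * q ^ sum_list bs) =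
        q ^ b * path_sum q l as' b - (\<Sum>bs\<in>bad b. q ^ b * q ^ sum_list bs)" by simp
  qed
  also have "\<dots> = (\<Sum>b\<le>a. q ^ b * path_sum q l as' b) -
      (\<Sum>b\<le>a. \<Sum>bs\<in>bad b. q ^ b * q ^ sum_list bs)"
    by (rule sum_subtractf)
  also have "(\<Sum>b\<le>a. q ^ b * path_sum q l as' b) =
      (\<Sum>b\<le>a. q ^ b) * fst (transfer q l (1, 0) as') +
      (\<Sum>b\<le>a. q ^ b * tail_weight q l b) * fst (transfer q l (0, 1) as')"
    by (simp add: path sum_distrib_right distrib_left sum.distrib mult.assoc)
  also have "\<dots> = geom q a * fst (transfer q l (1, 0) as') +
      link_weight q l * fst (transfer q l (0, 1) as')"
    using a by (subst sum_tail_weight) (auto simp: geom_def)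
  also have "(\<Sum>b\<le>a. \<Sum>bs\<in>bad b. q ^ b * q ^ sum_list bs) =
      (\<Sum>(b, bs)\<in>Sigma {..a} bad. q ^ b * q ^ sum_list bs)"
    by (rule sum.Sigma) (auto simp: fin)
  also have "\<dots> = (\<Sum>(bs, b)\<in>Sigma (link_paths l as' l) (\<lambda>bs. {a - l + hd (bs @ [l])<..a}).
      q ^ b * q ^ sum_list bs)"
  proof -
    \<comment> \<open>A violation forces b > a - l \<ge> l, so the end height can be replaced by
      \<open>l\<close>, which decouples \<open>b\<close> from the path. For a single chain, linked
      to itself, both sides are false.\<close>
    have *: "b \<le> a \<and> bs \<in> bad b \<longleftrightarrow> bs \<in> link_paths l as' l \<and> a - l + hd (bs @ [l]) < b \<and> b \<le> a"
      for b bs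
    proof (cases "a - l < b")
      case True
      then have "link_paths l as' b = link_paths l as' l"
        using a by (intro link_paths_cap[OF as']) auto
      then show ?thesis using a by (cases bs) (auto simp: bad_def)
    qed (auto simp: bad_def)
    have "(b, bs) \<in> Sigma {..a} bad \<longleftrightarrow>
        (bs, b) \<in> Sigma (link_paths l as' l) (\<lambda>bs. {a - l + hd (bs @ [l])<..a})" for b bs
      using *[of b bs] by simp
    then show ?thesis
      by (intro sum.reindex_bij_witness[of _ "\<lambda>(bs, b). (b, bs)" "\<lambda>(b, bs). (bs, b)"])
        (simp_all only: split_paired_all split_conv)
  qed
  also have "\<dots> = (\<Sum>bs\<in>link_paths l as' l. \<Sum>b\<in>{a - l + hd (bs @ [l])<..a}. q ^ b * q ^ sum_list bs)"
    by (rule sum.Sigma[symmetric]) (auto simp: finite_link_paths)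
  also have "\<dots> = q ^ a * tail_path_sum q l as' l"
    unfolding tail_path_sum_def sum_distrib_left
  proof (intro sum.cong refl)
    fix bs
    have "(\<Sum>b\<in>{a - l + hd (bs @ [l])<..a}. q ^ b) = q ^ a * tail_weight q l (hd (bs @ [l]))"
      using a assms(1) by (intro sum_above_link) auto
    then show "(\<Sum>b\<in>{a - l + hd (bs @ [l])<..a}. q ^ b * q ^ sum_list bs) =
        q ^ a * (q ^ sum_list bs * tail_weight q l (hd (bs @ [l])))"
      by (simp only: sum_distrib_right[symmetric] mult_ac)
  qed
  \<comment> \<open>At end height \<open>l\<close> the tail weight is 0, so the start vector is
    \<open>(1, 0)\<close>.\<close>
  also have "tail_path_sum q l as' l = snd (transfer q l (1, 0) as')"
    by (simp add: path tail_weight_eq_0)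
  finally show ?thesis by (simp add: as)
qed

section \<open>Ideals as vectors of column heights\<close>

text \<open>Closure under the generators propagates down any generating path, and generators lie
  inside the poset, so restricting the order loses none of them.\<close>

lemma lower_ideals_chainlink:
  assumes "composition a" "2 * l \<le> Min (set a)"
  shows "lower_ideals (chainlink_elems a) (chainlink_le a l) =
    {I. I \<subseteq> chainlink_elems a \<and> (\<forall>(x, y)\<in>chainlink_gen a l. y \<in> I \<longrightarrow> x \<in> I)}"
proof (intro set_eqI iffI)
  fix I assume I: "I \<in> lower_ideals (chainlink_elems a) (chainlink_le a l)"
  have "x \<in> I" if "(x, y) \<in> chainlink_gen a l" "y \<in> I" for x y
  proof -
    have "(x, y) \<in> chainlink_le a l" "x \<in> chainlink_elems a"
      using that(1) chainlink_gen_elems[OF assms] by (auto simp: chainlink_le_def)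
    then show ?thesis using I that(2) by (auto simp: lower_ideals_def)
  qed
  then show "I \<in> {I. I \<subseteq> chainlink_elems a \<and> (\<forall>(x, y)\<in>chainlink_gen a l. y \<in> I \<longrightarrow> x \<in> I)}"
    using I by (auto simp: lower_ideals_def)
next
  fix I assume I: "I \<in> {I. I \<subseteq> chainlink_elems a \<and> (\<forall>(x, y)\<in>chainlink_gen a l. y \<in> I \<longrightarrow> x \<in> I)}"
  have "x \<in> I" if "(x, y) \<in> (chainlink_gen a l)\<^sup>*" "y \<in> I" for x y
    using that by (induction rule: converse_rtrancl_induct) (use I in auto)
  then show "I \<in> lower_ideals (chainlink_elems a) (chainlink_le a l)"
    using I by (auto simp: lower_ideals_def chainlink_le_def)
qed

definition ideal_of :: "nat list \<Rightarrow> (nat \<times> nat) set" where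
  "ideal_of bs = Sigma {..<length bs} (\<lambda>i. {1..bs ! i})"

lemma card_ideal_of: "card (ideal_of bs) = sum_list bs"
  by (simp add: ideal_of_def sum_list_sum_nth atLeast0LessThan)

lemma down_closed_eq_atLeastAtMost:
  fixes J :: "nat set"
  assumes "J \<subseteq> {1..n}" "\<And>j. 1 \<le> j \<Longrightarrow> Suc j \<in> J \<Longrightarrow> j \<in> J"
  shows "J = {1..card J}"
proof (cases "J = {}")
  case False
  have fin: "finite J" using assms(1) finite_subset by blast
  have "j \<in> J" if "1 \<le> j" "j \<le> Max J" for j
    using that(2,1)
  proof (induction rule: inc_induct)
    case base
    show ?case by (rule Max_in[OF fin False])
  next
    case (step k)
    then show ?case by (metis assms(2) le_SucI)
  qed
  then have J: "J = {1..Max J}" using assms(1) Max_ge[OF fin] by (intro equalityI subsetI) auto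
  have "card J = Max J" using arg_cong[OF J, of card] by simp
  then show ?thesis by (simp only:) (rule J)
qed simp

text \<open>The inverse counts each column. Generators within a chain make the columns initial
  segments; the links between chains amount to the cyclic inequalities on heights.\<close>

lemma bij_betw_ideal_of:
  assumes "composition a" "2 * l \<le> Min (set a)"
  shows "bij_betw ideal_of (link_cycles l a)
    (lower_ideals (chainlink_elems a) (chainlink_le a l))"
proof (rule bij_betw_byWitness[where f' = "\<lambda>I. map (\<lambda>i. card {j. (i, j) \<in> I}) [0..<length a]"])
  have lt: "Suc i mod length a < length a" for i
    using assms(1) by (simp add: composition_def)
  show "\<forall>bs\<in>link_cycles l a. map (\<lambda>i. card {j. (i, j) \<in> ideal_of bs}) [0..<length a] = bs"
  proof
    fix bs assume "bs \<in> link_cycles l a"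
    then have "length bs = length a" by (simp add: link_cycles_def)
    moreover have "{j. (i, j) \<in> ideal_of bs} = {1..bs ! i}" if "i < length bs" for i
      using that by (auto simp: ideal_of_def)
    ultimately show "map (\<lambda>i. card {j. (i, j) \<in> ideal_of bs}) [0..<length a] = bs"
      by (intro nth_equalityI) auto
  qed
  have col: "{j. (i, j) \<in> I} = {1..card {j. (i, j) \<in> I}}"
    if I: "I \<in> lower_ideals (chainlink_elems a) (chainlink_le a l)" and i: "i < length a" for I i
  proof (rule down_closed_eq_atLeastAtMost)
    have sub: "I \<subseteq> chainlink_elems a" and cl: "\<forall>(x, y)\<in>chainlink_gen a l. y \<in> I \<longrightarrow> x \<in> I"
      using I unfolding lower_ideals_chainlink[OF assms] by auto
    show "{j. (i, j) \<in> I} \<subseteq> {1..a ! i}" using sub by (auto simp: chainlink_elems_def)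
    fix j assume "1 \<le> j" "Suc j \<in> {j. (i, j) \<in> I}"
    then have "((i, j), (i, Suc j)) \<in> chainlink_gen a l" "(i, Suc j) \<in> I"
      using i sub by (auto simp: chainlink_gen_def chainlink_elems_def)
    then show "j \<in> {j. (i, j) \<in> I}" using cl by auto
  qed
  show "\<forall>I\<in>lower_ideals (chainlink_elems a) (chainlink_le a l).
      ideal_of (map (\<lambda>i. card {j. (i, j) \<in> I}) [0..<length a]) = I"
  proof
    fix I assume I: "I \<in> lower_ideals (chainlink_elems a) (chainlink_le a l)"
    have I_lt: "i < length a" if "(i, j) \<in> I" for i j
      using I that by (auto simp: lower_ideals_def chainlink_elems_def)
    have I_iff: "(i, j) \<in> I \<longleftrightarrow> j \<in> {1..card {j. (i, j) \<in> I}}" if "i < length a" for i j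
      using col[OF I that] by blast
    have "(i, j) \<in> ideal_of (map (\<lambda>i. card {j. (i, j) \<in> I}) [0..<length a]) \<longleftrightarrow> (i, j) \<in> I" for i j
    proof (cases "i < length a")
      case True
      then have "(i, j) \<in> ideal_of (map (\<lambda>i. card {j. (i, j) \<in> I}) [0..<length a]) \<longleftrightarrow>
          j \<in> {1..card {j. (i, j) \<in> I}}" by (simp add: ideal_of_def)
      also have "\<dots> \<longleftrightarrow> (i, j) \<in> I" by (rule I_iff[OF True, symmetric])
      finally show ?thesis .
    qed (use I_lt in \<open>auto simp: ideal_of_def\<close>)
    then show "ideal_of (map (\<lambda>i. card {j. (i, j) \<in> I}) [0..<length a]) = I"
      by (intro set_eqI) (simp add: split_paired_all)
  qed
  show "ideal_of ` link_cycles l a \<subseteq> lower_ideals (chainlink_elems a) (chainlink_le a l)"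
  proof (intro image_subsetI)
    fix bs assume bs: "bs \<in> link_cycles l a"
    then have len: "length bs = length a"
      and le: "\<And>i. i < length a \<Longrightarrow> bs ! i \<le> a ! i"
      and link: "\<And>i. i < length a \<Longrightarrow> bs ! i \<le> a ! i - l + bs ! (Suc i mod length a)"
      by (auto simp: link_cycles_def)
    have "ideal_of bs \<subseteq> chainlink_elems a"
      using le by (auto simp: ideal_of_def chainlink_elems_def len intro: order_trans)
    \<comment> \<open>For a link, a_i - l + j \<le> b_i \<le> a_i - l + b_{i+1} yields j \<le>
      b_{i+1}.\<close>
    moreover have "x \<in> ideal_of bs" if "(x, y) \<in> chainlink_gen a l" "y \<in> ideal_of bs" for x y
      using that link lt by (fastforce simp: chainlink_gen_def ideal_of_def len)
    ultimately show "ideal_of bs \<in> lower_ideals (chainlink_elems a) (chainlink_le a l)"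
      unfolding lower_ideals_chainlink[OF assms] by auto
  qed
  show "(\<lambda>I. map (\<lambda>i. card {j. (i, j) \<in> I}) [0..<length a]) `
      lower_ideals (chainlink_elems a) (chainlink_le a l) \<subseteq> link_cycles l a"
  proof (intro image_subsetI)
    fix I assume I: "I \<in> lower_ideals (chainlink_elems a) (chainlink_le a l)"
    then have sub: "I \<subseteq> chainlink_elems a" and cl: "\<forall>(x, y)\<in>chainlink_gen a l. y \<in> I \<longrightarrow> x \<in> I"
      unfolding lower_ideals_chainlink[OF assms] by auto
    define n where "n i = card {j. (i, j) \<in> I}" for i
    have mem: "(i, j) \<in> I \<longleftrightarrow> 1 \<le> j \<and> j \<le> n i" if "i < length a" for i j
    proof -
      have "(i, j) \<in> I \<longleftrightarrow> j \<in> {1..card {j. (i, j) \<in> I}}" using col[OF I that] by blast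
      then show ?thesis by (simp only: n_def atLeastAtMost_iff)
    qed
    have le: "n i \<le> a ! i" if "i < length a" for i
    proof (cases "n i = 0")
      case False
      then have "(i, n i) \<in> I" using mem[OF that] by simp
      then show ?thesis using sub by (auto simp: chainlink_elems_def)
    qed simp
    have "n i \<le> a ! i - l + n (Suc i mod length a)" if i: "i < length a" for i
    proof (cases "n i \<le> a ! i - l")
      case False
      \<comment> \<open>The top element of column \<open>i\<close> is then the \<open>j\<close>-th
        linked one, and the link puts element \<open>j\<close> of the next chain into
        \<open>I\<close>.\<close>
      define j where "j = n i - (a ! i - l)"
      have j: "1 \<le> j" "j \<le> l" "n i = a ! i - l + j" using False le[OF i] by (auto simp: j_def)
      have "((Suc i mod length a, j), (i, a ! i - l + j)) \<in> chainlink_gen a l"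
        using i j by (auto simp: chainlink_gen_def)
      moreover have "(i, a ! i - l + j) \<in> I" using mem[OF i] j by auto
      ultimately have "(Suc i mod length a, j) \<in> I" using cl by auto
      then show ?thesis using mem[OF lt] j by auto
    qed simp
    then show "map (\<lambda>i. card {j. (i, j) \<in> I}) [0..<length a] \<in> link_cycles l a"
      using le lt by (auto simp: link_cycles_def n_def)
  qed
qed

section \<open>From evaluations to the palindromic identity\<close>

theorem corollary4p7:
  fixes a :: "nat list" and l :: nat
  assumes "composition a"
    and "0 < l"
    and "2 * l \<le> Min (set a)"
  shows "symmetric_poly (rank_poly (chainlink_elems a) (chainlink_le a l))"
proof -
  let ?f = "rank_poly (chainlink_elems a) (chainlink_le a l)"
  have ne: "a \<noteq> []" using assms(1) by (simp add: composition_def)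
  have ge: "\<forall>x\<in>set a. 2 * l \<le> x" using assms(3) ne by simp
  have eval: "poly ?f q = fst (transfer q l (1, 0) a) + snd (transfer q l (0, 1) a)"
    if "q \<noteq> 0" for q
  proof -
    have "poly ?f q =
        (\<Sum>I\<in>lower_ideals (chainlink_elems a) (chainlink_le a l). q ^ card I)"
      by (simp add: rank_poly_def poly_sum poly_monom)
    also have "\<dots> = (\<Sum>bs\<in>link_cycles l a. q ^ card (ideal_of bs))"
      by (rule sum.reindex_bij_betw[OF bij_betw_ideal_of[OF assms(1,3)], symmetric])
    also have "\<dots> = (\<Sum>bs\<in>link_cycles l a. q ^ sum_list bs)"
      by (simp add: card_ideal_of)
    finally show ?thesis using sum_link_cycles[OF that ne ge] by simp
  qed
  \<comment> \<open>The exponent is the number of elements of the poset. At q = 1 the claim is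
    trivial, while the closed form of the geometric sum used otherwise divides by q - 1.\<close>
  have "q powi int (sum_list a) * poly ?f (inverse q) = poly ?f q" if "q \<noteq> 0" for q :: real
  proof (cases "q = 1")
    case False
    have "q ^ sum_list a * poly ?f (inverse q) =
        fst (dual_transfer q l (1, 0) a) + snd (dual_transfer q l (0, 1) a)"
      using that by (simp add: eval distrib_left transfer_inverse)
    also have "\<dots> = poly ?f q"
      using that False by (simp add: eval trace_dual_transfer)
    finally show ?thesis by simp
  qed simp
  then show ?thesis unfolding symmetric_poly_def by blast
qed

end
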